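(* Let $r \ge 2$ be an integer. For every connected graph $G$ of order divisible by $r$, the graph $G^{2r-2}$ contains a $K_r$-factor. Moreover, this is best possible: there exists a connected graph $G$ of order divisible by $r$ such that $G^{2r-3}$ does not contain a $K_r$-factor.
   Context: Graphs are finite, and the order of a graph is its number of vertices. For a graph $G$ and $k \ge 1$, the $k$th power $G^k$ is the graph with the same vertex set as $G$ in which two distinct vertices are adjacent if and only if there is a path between them in $G$ of length at most $k$. A $K_r$-factor in a graph is a spanning subgraph in which every connected component is isomorphic to the complete graph $K_r$ on $r$ vertices. *)

theory Defs
  imports "Graph_Theory.Kuratowski"
begin

text \<open>
  A finite simple graph is a \<^locale>\<open>pair_graph\<close>: finitely many vertices, and a symmetric,
  loop-free set of arcs, so that an edge \<open>{u, v}\<close> is the pair of arcs \<open>(u, v)\<close> and \<open>(v, u)\<close>.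
  A graph with \<^const>\<open>Digraph_Component.connected\<close> is required to have at least one vertex.
\<close>

definition graph_power :: "'a pair_pre_digraph \<Rightarrow> nat \<Rightarrow> 'a pair_pre_digraph" where
  "graph_power G k = \<lparr> pverts = pverts G,
     parcs = {(u, v). u \<noteq> v \<and> (\<exists>p. pre_digraph.apath (with_proj G) u p v \<and> length p \<le> k)} \<rparr>"

text \<open>
  On a symmetric digraph \<open>H\<close>, the maximal connected sub-digraphs are the connected components
  of the undirected graph; \<^const>\<open>complete_digraph\<close> describes \<open>K\<^sub>r\<close> up to isomorphism.
\<close>

definition is_K_factor :: "nat \<Rightarrow> 'a pair_pre_digraph \<Rightarrow> 'a pair_pre_digraph \<Rightarrow> bool" where
  "is_K_factor r H G \<longleftrightarrow>
     pair_graph H \<and> spanning (with_proj H) (with_proj G) \<and>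
     (\<forall>C. pre_digraph.max_subgraph (with_proj H) Digraph_Component.connected C
            \<longrightarrow> complete_digraph r C)"

definition has_K_factor :: "nat \<Rightarrow> 'a pair_pre_digraph \<Rightarrow> bool" where
  "has_K_factor r G \<longleftrightarrow> (\<exists>H. is_K_factor r H G)"

end

theory Submission
  imports Defs "HOL-Library.Disjoint_Sets"
begin

text \<open>
  Orient a breadth-first tree towards its root and let \<open>v\<close> be a deepest vertex with at least \<open>r\<close>
  descendants, itself included. Every child of \<open>v\<close> has fewer than \<open>r\<close> descendants, so all descendants
  of \<open>v\<close> are within \<open>r - 1\<close> steps of \<open>v\<close> and within \<open>2r - 2\<close> of each other. Removing the \<open>r\<close>
  deepest of them leaves a tree with the same root, and one repeats.

  For sharpness take the spider with \<open>r + 1\<close> legs of length \<open>r - 1\<close>, which has \<open>r\<^sup>2\<close> vertices. Its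
  \<open>r + 1\<close> leaves are pairwise at distance \<open>2r - 2\<close>, so they would lie in different cliques of a
  factor of the power \<open>2r - 3\<close>, but a factor has only \<open>r\<close> cliques.
\<close>

section \<open>Connected components of symmetric digraphs\<close>

lemma (in wf_digraph) strongly_connected_imp_connected:
  assumes "strongly_connected G"
  shows "Digraph_Component.connected G"
  using assms reachable_mk_symmetricI
  by (intro connectedI) (auto simp: strongly_connected_def)

lemma (in sym_digraph) connected_subgraph_reachable:
  assumes "subgraph C G" "Digraph_Component.connected C" "u \<in> verts C" "v \<in> verts C"
  shows "u \<rightarrow>\<^sup>* v"
proof -
  have "u \<rightarrow>\<^sup>*\<^bsub>mk_symmetric C\<^esub> v"
    using assms(2-4) by (auto simp: connected_def strongly_connected_def)
  then have "u \<rightarrow>\<^sup>*\<^bsub>mk_symmetric G\<^esub> v"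
    using subgraph_mk_symmetric[OF assms(1)] by (rule pre_digraph.reachable_mono)
  then show ?thesis by (simp add: reachable_mk_symmetric_eq[OF sym_arcs])
qed

text \<open>Reachability inside \<open>C\<close> persists in \<open>G\<close>, so every vertex of
  \<open>C\<close> lies in the class of \<open>u\<close>; the arcs of \<open>C\<close> then follow
  because the larger graph is induced.\<close>

lemma (in sym_digraph) connected_subgraph_le_component:
  assumes "subgraph C G" "Digraph_Component.connected C" "u \<in> verts C"
  shows "subgraph C (G \<restriction> {v. u \<rightarrow>\<^sup>* v})"
proof (rule subgraphI)
  show sub: "verts C \<subseteq> verts (G \<restriction> {v. u \<rightarrow>\<^sup>* v})"
    using connected_subgraph_reachable[OF assms] by auto
  have wf: "wf_digraph C" and ends: "tail C = tail G" "head C = head G"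
    using assms(1) by (auto simp: subgraph_def compatible_def)
  show "wf_digraph C" by (fact wf)
  show "arcs C \<subseteq> arcs (G \<restriction> {v. u \<rightarrow>\<^sup>* v})"
  proof
    fix e assume e: "e \<in> arcs C"
    then have "e \<in> arcs G" using assms(1) by (auto simp: subgraph_def)
    moreover have "tail G e \<in> verts C" "head G e \<in> verts C"
      using wf_digraph.tail_in_verts[OF wf e] wf_digraph.head_in_verts[OF wf e] ends by auto
    ultimately show "e \<in> arcs (G \<restriction> {v. u \<rightarrow>\<^sup>* v})" using sub by auto
  qed
  show "compatible (G \<restriction> {v. u \<rightarrow>\<^sup>* v}) C" using ends by (auto simp: compatible_def)
qed (rule wellformed_induce_subgraph)

text \<open>Replaces the order-theoretic notion of component in \<open>is_K_factor\<close> by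
  reachability classes. It serves both to verify that a constructed subgraph is a factor and to
  extract cliques from a given one.\<close>

lemma (in sym_digraph) max_connected_subgraph_iff:
  "max_subgraph Digraph_Component.connected C \<longleftrightarrow> (\<exists>u\<in>verts G. C = G \<restriction> {v. u \<rightarrow>\<^sup>* v})"
proof -
  have comp: "subgraph (G \<restriction> {v. u \<rightarrow>\<^sup>* v}) G"
      "Digraph_Component.connected (G \<restriction> {v. u \<rightarrow>\<^sup>* v})" if "u \<in> verts G" for u
  proof -
    have "G \<restriction> {v. u \<rightarrow>\<^sup>* v} \<in> sccs" using that by (rule induce_reachable_is_in_sccs)
    then show "subgraph (G \<restriction> {v. u \<rightarrow>\<^sup>* v}) G"
        "Digraph_Component.connected (G \<restriction> {v. u \<rightarrow>\<^sup>* v})"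
      by (auto simp: sccs_def induced_subgraph_def
        intro: wf_digraph.strongly_connected_imp_connected)
  qed
  show ?thesis
  proof
    assume C: "max_subgraph Digraph_Component.connected C"
    then have sub: "subgraph C G" and conn: "Digraph_Component.connected C"
      by (auto simp: max_subgraph_def)
    from conn obtain u where u: "u \<in> verts C" by (auto simp: connected_conv)
    with sub have uG: "u \<in> verts G" by (auto simp: subgraph_def)
    have "subgraph C (G \<restriction> {v. u \<rightarrow>\<^sup>* v})"
      using sub conn u by (rule connected_subgraph_le_component)
    with C comp[OF uG] have "C = G \<restriction> {v. u \<rightarrow>\<^sup>* v}" unfolding max_subgraph_def by metis
    with uG show "\<exists>u\<in>verts G. C = G \<restriction> {v. u \<rightarrow>\<^sup>* v}" by blast
  next
    assume "\<exists>u\<in>verts G. C = G \<restriction> {v. u \<rightarrow>\<^sup>* v}"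
    then obtain u where u: "u \<in> verts G" and C: "C = G \<restriction> {v. u \<rightarrow>\<^sup>* v}" by blast
    show "max_subgraph Digraph_Component.connected C"
    proof (rule max_subgraphI)
      show "Digraph_Component.connected C" "subgraph C G" using comp[OF u] C by auto
    next
      fix D assume D: "C \<noteq> D" "subgraph C D" "subgraph D G"
      show "\<not> Digraph_Component.connected D"
      proof
        assume conn: "Digraph_Component.connected D"
        have "u \<in> verts C" using u C by simp
        then have "u \<in> verts D" using D(2) by (auto simp: subgraph_def)
        then have "subgraph D C"
          unfolding C by (rule connected_subgraph_le_component[OF D(3) conn])
        with D(2) have "D = C" by (auto simp: subgraph_def compatible_def)
        with D(1) show False by simp
      qed
    qed
  qed
qed

section \<open>Clique factors and graph powers\<close>

lemma graph_power_verts [simp]: "pverts (graph_power G k) = pverts G"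
  by (simp add: graph_power_def)

lemma pair_wf_digraph_graph_power:
  assumes "pair_wf_digraph G"
  shows "pair_wf_digraph (graph_power G k)"
proof -
  interpret pair_wf_digraph G by fact
  show ?thesis
    by unfold_locales (auto simp: graph_power_def apath_def awalk_hd_in_verts awalk_last_in_verts)
qed

lemma (in pair_wf_digraph) relpow_imp_awalk:
  assumes "(u, v) \<in> parcs G ^^ n" "u \<in> pverts G"
  shows "\<exists>p. awalk u p v \<and> length p = n"
  using assms
proof (induction n arbitrary: u)
  case 0
  then show ?case by (auto simp: awalk_Nil_iff)
next
  case (Suc n)
  then obtain w where w: "(u, w) \<in> parcs G" "(w, v) \<in> parcs G ^^ n"
    by (meson relpow_Suc_D2)
  with Suc.IH obtain p where "awalk w p v" "length p = n"
    using in_arcsD2 by blast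
  with w Suc.prems show ?case
    by (intro exI[of _ "(u, w) # p"]) (auto simp: awalk_Cons_iff)
qed

text \<open>\<open>graph_power\<close> asks for a path without repeated vertices, whereas relation
  powers only yield walks. Shortcutting a walk to a path does not lengthen it.\<close>

lemma (in pair_wf_digraph) graph_powerI:
  assumes "(u, v) \<in> parcs G ^^ n" "u \<in> pverts G" "n \<le> k" "u \<noteq> v"
  shows "(u, v) \<in> parcs (graph_power G k)"
proof -
  obtain p where p: "awalk u p v" "length p = n"
    using relpow_imp_awalk[OF assms(1,2)] by blast
  let ?q = "awalk_to_apath p"
  have q: "apath u ?q v" using p(1) by (rule apath_awalk_to_apath)
  \<comment> \<open>A path has distinct arcs, all of them taken from the walk, so the two lengths
    can be compared by counting arc sets.\<close>
  then have "distinct ?q" by (auto simp: apath_def intro: distinct_verts_imp_distinct)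
  then have "length ?q = card (set ?q)" by (simp add: distinct_card)
  also have "\<dots> \<le> card (set p)"
    using awalk_to_apath_subset[OF p(1)] by (simp add: card_mono)
  also have "\<dots> \<le> k" using p(2) assms(3) card_length[of p] by linarith
  finally show ?thesis using q assms(4) by (auto simp: graph_power_def)
qed

text \<open>Lower bound for distances: a potential that drops by at most one along each arc forces a
  walk to be at least as long as the total drop.\<close>

lemma (in pair_wf_digraph) awalk_lipschitz:
  fixes h :: "'a \<Rightarrow> int"
  assumes "awalk u p v" and "\<And>x y. (x, y) \<in> parcs G \<Longrightarrow> h x \<le> h y + 1"
  shows "h u \<le> h v + int (length p)"
  using assms(1)
proof (induction p arbitrary: u)
  case Nil
  then show ?case by (auto simp: awalk_Nil_iff)
next
  case (Cons e p)
  obtain x y where [simp]: "e = (x, y)" by fastforce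
  from Cons.prems have "x = u" "(x, y) \<in> parcs G" "awalk y p v"
    by (auto simp: awalk_Cons_iff)
  with Cons.IH[of y] assms(2)[of x y] show ?case by simp
qed

text \<open>The factor \<open>H\<close> joins any two distinct vertices of a common block. Its
  components are exactly the blocks, because blocks are disjoint and no arc of \<open>H\<close>
  leaves one.\<close>

lemma has_K_factorI:
  assumes P: "pair_wf_digraph P" "finite (pverts P)"
    and part: "partition_on (pverts P) \<P>"
    and card: "\<And>S. S \<in> \<P> \<Longrightarrow> card S = r"
    and clique: "\<And>S u v. S \<in> \<P> \<Longrightarrow> u \<in> S \<Longrightarrow> v \<in> S \<Longrightarrow> u \<noteq> v \<Longrightarrow> (u, v) \<in> parcs P"
  shows "has_K_factor r P"
proof -
  interpret P: pair_wf_digraph P by fact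
  define H where "H = \<lparr> pverts = pverts P,
    parcs = {(u, v). u \<noteq> v \<and> (\<exists>S\<in>\<P>. u \<in> S \<and> v \<in> S)} \<rparr>"
  have VH [simp]: "pverts H = pverts P"
    and EH: "(u, v) \<in> parcs H \<longleftrightarrow> u \<noteq> v \<and> (\<exists>S\<in>\<P>. u \<in> S \<and> v \<in> S)" for u v
    by (auto simp: H_def)
  have sub: "S \<subseteq> pverts P" if "S \<in> \<P>" for S
    using part that by (auto simp: partition_on_def)
  have EHV: "parcs H \<subseteq> pverts P \<times> pverts P" using sub by (fastforce simp: EH)
  have fin: "finite (parcs H)" using finite_subset[OF EHV] P(2) by simp
  have H: "pair_graph H"
    using EHV fin P(2) by unfold_locales (auto simp: EH symmetric_def intro!: symI)
  then interpret H: pair_graph H .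
  have span: "spanning (with_proj H) (with_proj P)"
    unfolding spanning_def
    using clique by (auto simp: EH H.wf_digraph P.wf_digraph intro!: subgraphI)
      (unfold_locales)
  have "complete_digraph r C"
    if C: "H.max_subgraph Digraph_Component.connected C" for C
  proof -
    obtain u where u: "u \<in> pverts P" and Cu: "C = with_proj H \<restriction> {v. u \<rightarrow>\<^sup>*\<^bsub>with_proj H\<^esub> v}"
      using C H.max_connected_subgraph_iff[of C] by auto
    obtain S where S: "S \<in> \<P>" "u \<in> S" using u part by (auto simp: partition_on_def)
    have uniq: "T = S" if "T \<in> \<P>" "x \<in> T" "x \<in> S" for T x
      using part S(1) that by (auto simp: partition_on_def disjoint_def)
    have "v \<in> S" if "u \<rightarrow>\<^sup>*\<^bsub>with_proj H\<^esub> v" for v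
      using that
    proof (induction rule: H.reachable_induct)
      case base
      then show ?case using S by simp
    next
      case (step x y)
      then show ?case using uniq by (auto simp: EH)
    qed
    moreover have "u \<rightarrow>\<^sup>*\<^bsub>with_proj H\<^esub> v" if "v \<in> S" for v
    proof (cases "u = v")
      case True
      then show ?thesis using u by auto
    next
      case False
      then have "(u, v) \<in> parcs H" using S that by (auto simp: EH)
      then show ?thesis by auto
    qed
    ultimately have reach: "{v. u \<rightarrow>\<^sup>*\<^bsub>with_proj H\<^esub> v} = S" by blast
    have "C = with_proj \<lparr> pverts = S, parcs = {(x, y). (x, y) \<in> S \<times> S \<and> x \<noteq> y} \<rparr>"
      unfolding Cu reach using S by (auto simp: induce_subgraph_def with_proj_def EH)
    then show ?thesis
      using card[OF S(1)] finite_subset[OF sub[OF S(1)] P(2)]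
      by (simp add: complete_digraph_pair_def)
  qed
  with H span show ?thesis unfolding has_K_factor_def is_K_factor_def by blast
qed

text \<open>Every component of the factor is a clique and so meets \<open>I\<close> at most once.
  The components of the vertices of \<open>I\<close> are thus disjoint sets of \<open>r\<close>
  vertices each.\<close>

lemma K_factor_independent_set:
  assumes "has_K_factor r P" and "finite (pverts P)" and "I \<subseteq> pverts P"
    and indep: "\<And>u v. u \<in> I \<Longrightarrow> v \<in> I \<Longrightarrow> (u, v) \<notin> parcs P"
  shows "card I * r \<le> card (pverts P)"
proof -
  obtain H where H: "pair_graph H" and span: "spanning (with_proj H) (with_proj P)"
    and comp: "\<And>C. pre_digraph.max_subgraph (with_proj H) Digraph_Component.connected C
      \<Longrightarrow> complete_digraph r C"
    using assms(1) unfolding has_K_factor_def is_K_factor_def by blast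
  interpret H: pair_graph H by fact
  have VH: "pverts H = pverts P" and EH: "parcs H \<subseteq> parcs P"
    using span by (auto simp: spanning_def subgraph_def)
  define R where "R u = {v. u \<rightarrow>\<^sup>*\<^bsub>with_proj H\<^esub> v}" for u
  have K: "complete_digraph r (with_proj H \<restriction> R u)" if "u \<in> I" for u
    unfolding R_def using that assms(3) VH
    by (intro comp, subst H.max_connected_subgraph_iff) auto
  have cardR: "card (R u) = r" if "u \<in> I" for u
    using K[OF that] by (simp add: complete_digraph_def)
  have RV: "R u \<subseteq> pverts P" for u
    using H.reachable_in_verts VH by (auto simp: R_def)
  \<comment> \<open>If two classes met, \<open>u\<close> and \<open>v\<close> would share a
    component; completeness would make them adjacent in \<open>H\<close>, hence in \<open>P\<close>,
    against independence.\<close>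
  have disj: "R u \<inter> R v = {}" if uv: "u \<in> I" "v \<in> I" "u \<noteq> v" for u v
  proof (rule ccontr)
    assume "R u \<inter> R v \<noteq> {}"
    then obtain w where "u \<rightarrow>\<^sup>*\<^bsub>with_proj H\<^esub> w" "v \<rightarrow>\<^sup>*\<^bsub>with_proj H\<^esub> w" by (auto simp: R_def)
    then have "u \<rightarrow>\<^sup>*\<^bsub>with_proj H\<^esub> v" using H.symmetric_reachable' H.reachable_trans by metis
    moreover have "u \<rightarrow>\<^sup>*\<^bsub>with_proj H\<^esub> u" using uv assms(3) VH by auto
    ultimately have "(u, v) \<in> arcs_ends (with_proj H \<restriction> R u)"
      using K[OF uv(1)] uv by (auto simp: complete_digraph_def R_def)
    then have "(u, v) \<in> parcs H" by (auto dest: dominates_induce_subgraphD)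
    with EH indep uv show False by blast
  qed
  have finI: "finite I" using assms(2,3) by (rule finite_subset[rotated])
  have "card (\<Union>u\<in>I. R u) = (\<Sum>u\<in>I. card (R u))"
    using finI finite_subset[OF RV assms(2)] disj by (intro card_UN_disjoint) auto
  also have "\<dots> = card I * r" using cardR by simp
  finally have "card I * r = card (\<Union>u\<in>I. R u)" ..
  also have "\<dots> \<le> card (pverts P)" using RV assms(2) by (intro card_mono) auto
  finally show ?thesis .
qed

section \<open>Partitioning a rooted tree\<close>

text \<open>On a shortest way from \<open>x\<close> to \<open>c\<close> all iterates are distinct,
  and each of them is a descendant of \<open>c\<close>. Hence a way of \<open>m\<close> steps
  accounts for \<open>m + 1\<close> descendants.\<close>

lemma funpow_reaches_within_card:
  fixes f :: "'a \<Rightarrow> 'a"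
  assumes "finite V" "f ` V \<subseteq> V" "x \<in> V" "(f ^^ i) x = c"
  shows "\<exists>j < card {y \<in> V. \<exists>i. (f ^^ i) y = c}. (f ^^ j) x = c"
proof -
  let ?D = "{y \<in> V. \<exists>i. (f ^^ i) y = c}"
  define m where "m = (LEAST i. (f ^^ i) x = c)"
  have m: "(f ^^ m) x = c" unfolding m_def using assms(4) by (rule LeastI)
  have least: "m \<le> i" if "(f ^^ i) x = c" for i
    unfolding m_def using that by (rule Least_le)
  have V: "(f ^^ j) x \<in> V" for j using assms(2,3) by (induction j) auto
  have "inj_on (\<lambda>j. (f ^^ j) x) {..m}"
  proof (rule linorder_inj_onI')
    fix j k assume jk: "j \<in> {..m}" "k \<in> {..m}" "j < k"
    show "(f ^^ j) x \<noteq> (f ^^ k) x"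
    proof
      assume eq: "(f ^^ j) x = (f ^^ k) x"
      \<comment> \<open>Cutting out the loop between steps \<open>j\<close> and \<open>k\<close>
        would reach \<open>c\<close> in fewer than \<open>m\<close> steps.\<close>
      have "(f ^^ (m - k + j)) x = (f ^^ (m - k)) ((f ^^ k) x)"
        by (simp add: funpow_add eq)
      also have "\<dots> = (f ^^ (m - k + k)) x" by (simp only: funpow_add o_apply)
      also have "\<dots> = c" using m jk by simp
      finally show False using least jk by fastforce
    qed
  qed
  moreover have "(\<lambda>j. (f ^^ j) x) ` {..m} \<subseteq> ?D"
  proof
    fix y assume "y \<in> (\<lambda>j. (f ^^ j) x) ` {..m}"
    then obtain j where j: "j \<le> m" "y = (f ^^ j) x" by auto
    then have "(f ^^ (m - j)) y = (f ^^ (m - j + j)) x" by (simp only: funpow_add o_apply)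
    then show "y \<in> ?D" using j m V by auto
  qed
  ultimately have "card {..m} \<le> card ?D"
    using assms(1) by (intro card_inj_on_le) auto
  then have "m < card ?D" by simp
  with m show ?thesis by blast
qed

text \<open>Greedy choice: a maximiser of \<open>d\<close> among the remaining elements is added
  \<open>k\<close> times.\<close>

lemma obtain_top_subset:
  fixes d :: "'a \<Rightarrow> nat"
  assumes "finite A" "k \<le> card A"
  shows "\<exists>S\<subseteq>A. card S = k \<and> (\<forall>x\<in>S. \<forall>y\<in>A - S. d y \<le> d x)"
  using assms(2)
proof (induction k)
  case 0
  then show ?case by (intro exI[of _ "{}"]) auto
next
  case (Suc k)
  then obtain S where S: "S \<subseteq> A" "card S = k" "\<forall>x\<in>S. \<forall>y\<in>A - S. d y \<le> d x" by auto
  have "A - S \<noteq> {}" using Suc.prems S(1,2) by auto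
  then obtain z where z: "z \<in> A - S" "\<forall>y\<in>A - S. d y \<le> d z"
    using assms(1) by (metis finite_Diff obtains_MAX Max_ge finite_imageI imageI)
  have "finite S" using S(1) assms(1) by (rule finite_subset)
  then show ?case using S z by (intro exI[of _ "insert z S"]) auto
qed

text \<open>Here \<open>f\<close> is the parent map, which can fix only the root \<open>z\<close>,
  and \<open>d\<close> acts as depth. Closure of \<open>V - S\<close> under \<open>f\<close> says
  that no remaining vertex loses its parent, so the same \<open>f\<close>, \<open>d\<close> and
  \<open>z\<close> serve for the rest.\<close>

lemma rooted_tree_cluster:
  fixes f :: "'a \<Rightarrow> 'a" and d :: "'a \<Rightarrow> nat"
  assumes V: "finite V" "V \<noteq> {}" "r \<le> card V" and "0 < r"
    and closed: "f ` V \<subseteq> V"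
    and depth: "\<And>x. x \<in> V \<Longrightarrow> f x \<noteq> x \<Longrightarrow> d (f x) < d x"
    and root: "\<And>x. x \<in> V \<Longrightarrow> f x = x \<Longrightarrow> x = z"
  shows "\<exists>S\<subseteq>V. card S = r \<and> f ` (V - S) \<subseteq> V - S \<and> (\<exists>v. \<forall>x\<in>S. \<exists>i<r. (f ^^ i) x = v)"
proof -
  \<comment> \<open>\<open>D v\<close> collects the descendants of \<open>v\<close> in
    \<open>V\<close>, including \<open>v\<close> itself when it lies in \<open>V\<close>.\<close>
  define D where "D v = {x \<in> V. \<exists>i. (f ^^ i) x = v}" for v
  have reach: "\<exists>i. (f ^^ i) x = z \<and> z \<in> V" if "x \<in> V" for x
    using that
  proof (induction "d x" arbitrary: x rule: less_induct)
    case less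
    show ?case
    proof (cases "f x = x")
      case True
      then have "x = z" using root less.prems by blast
      then show ?thesis using less.prems by (intro exI[of _ 0]) auto
    next
      case False
      then obtain i where "(f ^^ i) (f x) = z" "z \<in> V"
        using less depth closed by blast
      then have "(f ^^ Suc i) x = z" by (simp only: funpow_Suc_right o_apply)
      then show ?thesis using \<open>z \<in> V\<close> by blast
    qed
  qed
  then have "D z = V" by (auto simp: D_def)
  moreover have "z \<in> V" using reach V(2) by blast
  ultimately have "{v \<in> V. r \<le> card (D v)} \<noteq> {}" using V(3) by auto
  moreover have "finite {v \<in> V. r \<le> card (D v)}" using V(1) by simp
  \<comment> \<open>The root has all of \<open>V\<close> as descendants, so there is a candidate and
    hence a deepest one.\<close>
  ultimately obtain v where v: "v \<in> V" "r \<le> card (D v)"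
    and deepest: "\<And>w. w \<in> V \<Longrightarrow> r \<le> card (D w) \<Longrightarrow> d w \<le> d v"
    by (smt (verit, ccfv_threshold) Max_ge finite_imageI imageI mem_Collect_eq obtains_MAX)
  have near: "\<exists>i<r. (f ^^ i) x = v" if x: "x \<in> D v" for x
  proof (cases "x = v")
    case True
    then show ?thesis using \<open>0 < r\<close> by (intro exI[of _ 0]) simp
  next
    case False
    define m where "m = (LEAST i. (f ^^ i) x = v)"
    have m: "(f ^^ m) x = v" unfolding m_def using x by (auto simp: D_def intro: LeastI)
    with False obtain m' where m': "m = Suc m'" by (cases m) auto
    \<comment> \<open>\<open>c\<close> is the child of \<open>v\<close> through which
      \<open>x\<close> first reaches \<open>v\<close>. Minimality of \<open>m\<close> gives
      \<open>c \<noteq> v\<close>, which excludes the stationary step at the root and makes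
      \<open>c\<close> strictly deeper than \<open>v\<close>.\<close>
    define c where "c = (f ^^ m') x"
    have fc: "f c = v" using m m' by (simp add: c_def)
    have "c \<noteq> v" using not_less_Least[of m' "\<lambda>i. (f ^^ i) x = v"] m' by (auto simp: c_def m_def)
    have xV: "x \<in> V" using x by (simp add: D_def)
    have cV: "c \<in> V" unfolding c_def using closed xV by (induction m') auto
    have "d v < d c" using depth[OF cV] fc \<open>c \<noteq> v\<close> by auto
    then have small: "card (D c) < r" using deepest[OF cV] by linarith
    \<comment> \<open>With \<open>j < card (D c) < r\<close>, the extra step from \<open>c\<close>
      to \<open>v\<close> still leaves \<open>Suc j < r\<close>.\<close>
    obtain j where j: "j < card (D c)" "(f ^^ j) x = c"
      using funpow_reaches_within_card[OF V(1) closed xV, of m' c] by (auto simp: c_def D_def)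
    then have "(f ^^ Suc j) x = v" using fc by simp
    then show ?thesis using j(1) small by (intro exI[of _ "Suc j"]) auto
  qed
  have "finite (D v)" using V(1) by (simp add: D_def)
  from obtain_top_subset[OF this v(2), of d] obtain S where S: "S \<subseteq> D v" "card S = r"
    "\<forall>x\<in>S. \<forall>y\<in>D v - S. d y \<le> d x" by blast
  \<comment> \<open>A vertex outside \<open>S\<close> with its parent in \<open>S\<close> would be a
    descendant of \<open>v\<close> strictly deeper than an element of \<open>S\<close>, although
    \<open>S\<close> takes the deepest ones.\<close>
  have "f y \<in> V - S" if y: "y \<in> V - S" for y
  proof (rule ccontr)
    assume "f y \<notin> V - S"
    then have fy: "f y \<in> S" using y closed by auto
    then obtain i where "(f ^^ i) (f y) = v" using S(1) by (auto simp: D_def)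
    then have "(f ^^ Suc i) y = v" by (simp only: funpow_Suc_right o_apply)
    then have "y \<in> D v - S" using y unfolding D_def by blast
    then have "d y \<le> d (f y)" using S(3) fy by blast
    then have "f y = y" using depth[of y] y by force
    then show False using fy y by auto
  qed
  moreover have "S \<subseteq> V" using S(1) by (auto simp: D_def)
  ultimately show ?thesis using S near by (intro exI[of _ S]) blast
qed

text \<open>Clusters are split off by induction on \<open>card V\<close>. Divisibility by
  \<open>r\<close> is preserved, so a nonempty remainder is always large enough for another
  cluster.\<close>

lemma rooted_tree_partition:
  fixes f :: "'a \<Rightarrow> 'a" and d :: "'a \<Rightarrow> nat"
  assumes "finite V" "r dvd card V" "0 < r" "f ` V \<subseteq> V"
    and "\<And>x. x \<in> V \<Longrightarrow> f x \<noteq> x \<Longrightarrow> d (f x) < d x"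
    and "\<And>x. x \<in> V \<Longrightarrow> f x = x \<Longrightarrow> x = z"
  shows "\<exists>\<P>. partition_on V \<P> \<and>
    (\<forall>S\<in>\<P>. card S = r \<and> (\<exists>v. \<forall>x\<in>S. \<exists>i<r. (f ^^ i) x = v))"
  using assms
proof (induction "card V" arbitrary: V rule: less_induct)
  case less
  show ?case
  proof (cases "V = {}")
    case True
    then show ?thesis by (intro exI[of _ "{}"]) (auto simp: partition_on_def)
  next
    case False
    then have "r \<le> card V" using less.prems(1,2) by (intro dvd_imp_le) (auto simp: card_gt_0_iff)
    then obtain S where S: "S \<subseteq> V" "card S = r" "f ` (V - S) \<subseteq> V - S"
      "\<exists>v. \<forall>x\<in>S. \<exists>i<r. (f ^^ i) x = v"
      using rooted_tree_cluster[of V r f d z] less.prems False by blast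
    have finS: "finite S" using S(1) less.prems(1) by (rule finite_subset)
    have card: "card (V - S) = card V - r" using S(1,2) finS by (simp add: card_Diff_subset)
    have "card (V - S) < card V" using card \<open>r \<le> card V\<close> less.prems(3) by linarith
    moreover have "r dvd card (V - S)" using card less.prems(2) by (simp add: dvd_diff_nat)
    ultimately obtain \<P> where P: "partition_on (V - S) \<P>"
      "\<forall>S\<in>\<P>. card S = r \<and> (\<exists>v. \<forall>x\<in>S. \<exists>i<r. (f ^^ i) x = v)"
      using less.hyps[of "V - S"] less.prems S(3) by auto
    have "S \<noteq> {}" using S(2) less.prems(3) by auto
    moreover have "disjnt S (\<Union>\<P>)" using P(1) by (auto simp: partition_on_def disjnt_def)
    ultimately have "partition_on V (insert S \<P>)"
      using P(1) S(1) by (simp add: partition_on_insert)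
    moreover have "\<forall>T\<in>insert S \<P>. card T = r \<and> (\<exists>v. \<forall>x\<in>T. \<exists>i<r. (f ^^ i) x = v)"
      using P(2) S(2,4) by simp
    ultimately show ?thesis by (intro exI[of _ "insert S \<P>"] conjI)
  qed
qed

text \<open>The breadth-first tree is encoded as a total parent map: the root is sent to itself, and
  any other vertex to a neighbour strictly closer to the root.\<close>

lemma (in pair_sym_digraph) connected_obtain_parents:
  assumes "Digraph_Component.connected (with_proj G)"
  obtains z f and d :: "'a \<Rightarrow> nat"
  where "\<And>x. x \<in> pverts G \<Longrightarrow> f x \<in> pverts G"
    and "\<And>x. x \<in> pverts G \<Longrightarrow> f x \<noteq> x \<Longrightarrow> (x, f x) \<in> parcs G \<and> d (f x) < d x"
    and "\<And>x. x \<in> pverts G \<Longrightarrow> f x = x \<Longrightarrow> x = z"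
proof -
  have sc: "strongly_connected (with_proj G)"
    using sym_arcs assms by (rule symmetric_connected_imp_strongly_connected)
  then obtain z where z: "z \<in> pverts G" by (auto simp: strongly_connected_def)
  \<comment> \<open>The least exponent is the distance to \<open>z\<close>; it exists because every
    vertex reaches \<open>z\<close>.\<close>
  define d where "d x = (LEAST n. (x, z) \<in> parcs G ^^ n)" for x
  have dist: "(x, z) \<in> parcs G ^^ d x" if "x \<in> pverts G" for x
  proof -
    have "x \<rightarrow>\<^sup>*\<^bsub>with_proj G\<^esub> z" using sc z that by (auto simp: strongly_connected_def)
    then have "(x, z) \<in> (parcs G)\<^sup>*" using reachable_rtranclI[of "with_proj G" x z] by simp
    then show ?thesis unfolding d_def rtrancl_power by (auto intro: LeastI)
  qed
  have "\<exists>y. (x, y) \<in> parcs G \<and> d y < d x" if x: "x \<in> pverts G" "x \<noteq> z" for x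
  proof -
    obtain n where n: "d x = Suc n" using dist[OF x(1)] x(2) by (cases "d x") auto
    then obtain y where y: "(x, y) \<in> parcs G" "(y, z) \<in> parcs G ^^ n"
      using dist[OF x(1)] relpow_Suc_D2 by metis
    then have "d y \<le> n" unfolding d_def by (intro Least_le)
    with y n show ?thesis by auto
  qed
  then obtain g where g: "\<And>x. x \<in> pverts G \<Longrightarrow> x \<noteq> z \<Longrightarrow> (x, g x) \<in> parcs G \<and> d (g x) < d x"
    by metis
  show ?thesis
  proof (rule that[of "\<lambda>x. if x = z then z else g x" d z])
    fix x assume x: "x \<in> pverts G"
    then show "(if x = z then z else g x) \<in> pverts G" using g z in_arcsD2 by auto
    show "(x, if x = z then z else g x) \<in> parcs G \<and> d (if x = z then z else g x) < d x"
      if "(if x = z then z else g x) \<noteq> x" using that g x by (auto split: if_splits)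
    show "x = z" if "(if x = z then z else g x) = x" using that g[OF x] by (metis less_irrefl)
  qed
qed

text \<open>Two vertices of one block climb to a common vertex in at most \<open>r - 1\<close> steps
  each, and the second climb can be reversed by symmetry.\<close>

lemma connected_graph_power_has_K_factor:
  assumes G: "pair_graph G" "Digraph_Component.connected (with_proj G)"
    and r: "r dvd card (pverts G)" "0 < r"
  shows "has_K_factor r (graph_power G (2 * r - 2))"
proof -
  interpret pair_graph G by fact
  obtain z f and d :: "'a \<Rightarrow> nat" where V: "\<And>x. x \<in> pverts G \<Longrightarrow> f x \<in> pverts G"
    and arc: "\<And>x. x \<in> pverts G \<Longrightarrow> f x \<noteq> x \<Longrightarrow> (x, f x) \<in> parcs G \<and> d (f x) < d x"
    and root: "\<And>x. x \<in> pverts G \<Longrightarrow> f x = x \<Longrightarrow> x = z"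
    using G(2) by (rule connected_obtain_parents) blast
  obtain \<P> where part: "partition_on (pverts G) \<P>"
    and P: "\<And>S. S \<in> \<P> \<Longrightarrow> card S = r \<and> (\<exists>v. \<forall>x\<in>S. \<exists>i<r. (f ^^ i) x = v)"
    using rooted_tree_partition[OF pair_finite_verts r, of f d z] V arc root
    by (metis image_subsetI)
  \<comment> \<open>Iterating \<open>f\<close> may stall at the root, so \<open>i\<close> iterations
    yield a walk of some length \<open>n \<le> i\<close> rather than exactly
    \<open>i\<close>.\<close>
  have walk: "\<exists>n\<le>i. (x, (f ^^ i) x) \<in> parcs G ^^ n" if "x \<in> pverts G" for x i
  proof (induction i)
    case 0
    then show ?case by simp
  next
    case (Suc i)
    then obtain n where n: "n \<le> i" "(x, (f ^^ i) x) \<in> parcs G ^^ n" by blast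
    have "(f ^^ i) x \<in> pverts G" using V that by (induction i) auto
    show ?case
    proof (cases "f ((f ^^ i) x) = (f ^^ i) x")
      case True
      then show ?thesis using n by (intro exI[of _ n]) auto
    next
      case False
      then have "((f ^^ i) x, (f ^^ Suc i) x) \<in> parcs G" using arc \<open>(f ^^ i) x \<in> pverts G\<close> by simp
      then have "(x, (f ^^ Suc i) x) \<in> parcs G ^^ Suc n" using n(2) by (rule relpow_Suc_I[rotated])
      then show ?thesis using n(1) by (intro exI[of _ "Suc n"]) blast
    qed
  qed
  have flip: "(y, x) \<in> parcs G ^^ n" if "(x, y) \<in> parcs G ^^ n" for x y n
    using that
  proof (induction n arbitrary: x)
    case 0
    then show ?case by simp
  next
    case (Suc n)
    then obtain w where "(x, w) \<in> parcs G" "(w, y) \<in> parcs G ^^ n" by (meson relpow_Suc_D2)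
    then show ?case using Suc.IH arcs_symmetric by (meson relpow_Suc_I)
  qed
  show ?thesis
  proof (rule has_K_factorI)
    show "pair_wf_digraph (graph_power G (2 * r - 2))"
      by (rule pair_wf_digraph_graph_power) unfold_locales
    show "finite (pverts (graph_power G (2 * r - 2)))" using pair_finite_verts by simp
    show "partition_on (pverts (graph_power G (2 * r - 2))) \<P>" using part by simp
    show "card S = r" if "S \<in> \<P>" for S using P that by blast
    fix S x y assume S: "S \<in> \<P>" and xy: "x \<in> S" "y \<in> S" "x \<noteq> y"
    have V: "x \<in> pverts G" "y \<in> pverts G" using part S xy by (auto simp: partition_on_def)
    obtain v i j where "i < r" "(f ^^ i) x = v" "j < r" "(f ^^ j) y = v"
      using P[OF S] xy by metis
    then obtain m n where mn: "m \<le> i" "(x, v) \<in> parcs G ^^ m" "n \<le> j" "(y, v) \<in> parcs G ^^ n"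
      and ij: "i < r" "j < r"
      using walk V by metis
    have "(x, y) \<in> parcs G ^^ (m + n)" using mn(2) flip[OF mn(4)] by (auto simp: relpow_add)
    then show "(x, y) \<in> parcs (graph_power G (2 * r - 2))"
      using V(1) mn ij xy(3) by (intro graph_powerI[of x y "m + n"]) auto
  qed
qed

section \<open>The extremal spider\<close>

text \<open>
  Vertex \<open>0\<close> is the centre, and the \<open>m\<close> legs are the residue classes modulo \<open>m\<close> of the positive
  vertices. Truncated subtraction makes the centre the neighbour of the first vertices \<open>1, \<dots>, m\<close>
  of the legs.
\<close>

definition spider :: "nat \<Rightarrow> nat \<Rightarrow> nat pair_pre_digraph" where
  "spider m N = \<lparr> pverts = {..<N},
     parcs = {(x, y). x < N \<and> y < N \<and> x \<noteq> y \<and> (y = x - m \<or> x = y - m)} \<rparr>"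

lemma spider_simps [simp]:
  "pverts (spider m N) = {..<N}"
  "(x, y) \<in> parcs (spider m N) \<longleftrightarrow> x < N \<and> y < N \<and> x \<noteq> y \<and> (y = x - m \<or> x = y - m)"
  by (simp_all add: spider_def)

lemma pair_graph_spider: "pair_graph (spider m N)"
proof
  show "finite (parcs (spider m N))"
    by (rule finite_subset[of _ "{..<N} \<times> {..<N}"]) (auto simp: spider_def)
qed (auto simp: symmetric_def spider_def intro!: symI)

lemma connected_spider:
  assumes "0 < m" "0 < N"
  shows "Digraph_Component.connected (with_proj (spider m N))"
proof -
  interpret pair_graph "spider m N" by (rule pair_graph_spider)
  have center: "x \<rightarrow>\<^sup>*\<^bsub>with_proj (spider m N)\<^esub> 0" if "x < N" for x
    using that
  proof (induction x rule: less_induct)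
    case (less x)
    show ?case
    proof (cases "x = 0")
      case True
      then show ?thesis using assms by auto
    next
      case False
      then have "x - m < x" using assms by simp
      then have "(x, x - m) \<in> parcs (spider m N)" "(x - m) \<rightarrow>\<^sup>*\<^bsub>with_proj (spider m N)\<^esub> 0"
        using less by auto
      then show ?thesis using adj_reachable_trans[of x "x - m" 0] by simp
    qed
  qed
  have "strongly_connected (with_proj (spider m N))"
  proof (rule strongly_connectedI)
    show "verts (with_proj (spider m N)) \<noteq> {}" using assms by auto
    fix u v assume "u \<in> verts (with_proj (spider m N))" "v \<in> verts (with_proj (spider m N))"
    then have "u \<rightarrow>\<^sup>*\<^bsub>with_proj (spider m N)\<^esub> 0" "v \<rightarrow>\<^sup>*\<^bsub>with_proj (spider m N)\<^esub> 0"
      using center by auto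
    then show "u \<rightarrow>\<^sup>*\<^bsub>with_proj (spider m N)\<^esub> v"
      using symmetric_reachable' reachable_trans by metis
  qed
  then show ?thesis by (rule strongly_connected_imp_connected)
qed

text \<open>The vertex \<open>l * m + Suc a\<close> has depth \<open>Suc l\<close> on leg
  \<open>a\<close>. Passing between two legs goes through the centre, which a signed depth
  measures.\<close>

lemma spider_leaves_not_adjacent:
  assumes ab: "a < m" "b < m" "a \<noteq> b"
    and k: "k < 2 * Suc l"
  shows "(l * m + Suc a, l * m + Suc b) \<notin> parcs (graph_power (spider m N) k)"
proof
  assume "(l * m + Suc a, l * m + Suc b) \<in> parcs (graph_power (spider m N) k)"
  interpret pair_graph "spider m N" by (rule pair_graph_spider)
  obtain p where p: "awalk (l * m + Suc a) p (l * m + Suc b)" "length p \<le> k"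
    using \<open>_ \<in> parcs (graph_power _ _)\<close> by (auto simp: graph_power_def apath_def)
  \<comment> \<open>the depth, counted positively on the leg of \<open>a\<close> and negatively on the other legs\<close>
  define h :: "nat \<Rightarrow> int" where
    "h x = (if x = 0 then 0 else if (x - 1) mod m = a then int ((x - 1) div m) + 1
      else - int ((x - 1) div m) - 1)" for x
  \<comment> \<open>A vertex \<open>x \<le> m\<close> is the centre or adjacent to it. Beyond that,
    subtracting \<open>m\<close> stays on the leg and lowers the depth by one.\<close>
  have step: "\<bar>h x - h (x - m)\<bar> \<le> 1" for x
  proof (cases "x \<le> m")
    case True
    then have "x = 0 \<or> (x - 1) div m = 0" using ab(1) by (cases x) auto
    then show ?thesis using True by (auto simp: h_def)
  next
    case False
    then have "(x - 1) div m = Suc ((x - m - 1) div m)" "(x - 1) mod m = (x - m - 1) mod m"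
      using ab(1) le_div_geq[of m "x - 1"] le_mod_geq[of m "x - 1"] by (auto simp: diff_commute)
    then show ?thesis using False by (auto simp: h_def)
  qed
  have "h (l * m + Suc a) \<le> h (l * m + Suc b) + int (length p)"
  proof (rule awalk_lipschitz[OF p(1)])
    fix x y assume "(x, y) \<in> parcs (spider m N)"
    then show "h x \<le> h y + 1" using step[of x] step[of y] by auto
  qed
  \<comment> \<open>The potential drops by \<open>2 * l + 2\<close> between the two vertices, more
    than \<open>k\<close> allows.\<close>
  moreover have "h (l * m + Suc a) = int l + 1" "h (l * m + Suc b) = - int l - 1"
    using ab by (auto simp: h_def)
  moreover have "length p < 2 * l + 2" using p(2) k by simp
  ultimately show False by simp
qed

lemma spider_power_no_K_factor:
  assumes "2 \<le> r"
  shows "\<not> has_K_factor r (graph_power (spider (r + 1) (r * r)) (2 * r - 3))"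
proof
  assume K: "has_K_factor r (graph_power (spider (r + 1) (r * r)) (2 * r - 3))"
  \<comment> \<open>The shift by two removes truncated subtraction: the leaves have depth
    \<open>l + 1 = r - 1\<close>, and \<open>2 * r - 3 = 2 * l + 1\<close> is just below
    \<open>2 * Suc l\<close>.\<close>
  obtain l where l: "r = l + 2" using assms nat_le_iff_add by (metis add.commute)
  let ?I = "(\<lambda>a. l * (r + 1) + Suc a) ` {..<r + 1}"
  interpret pair_graph "spider (r + 1) (r * r)" by (rule pair_graph_spider)
  have "card ?I * r \<le> card (pverts (graph_power (spider (r + 1) (r * r)) (2 * r - 3)))"
  proof (rule K_factor_independent_set[OF K])
    show "finite (pverts (graph_power (spider (r + 1) (r * r)) (2 * r - 3)))" by simp
    \<comment> \<open>The largest leaf is \<open>(l + 1) * (r + 1) = r * r - 1\<close>, exactly the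
      last vertex.\<close>
    show "?I \<subseteq> pverts (graph_power (spider (r + 1) (r * r)) (2 * r - 3))"
      by (auto simp: l algebra_simps)
    fix u v assume "u \<in> ?I" "v \<in> ?I"
    then obtain a b where ab: "a < r + 1" "b < r + 1"
      "u = l * (r + 1) + Suc a" "v = l * (r + 1) + Suc b" by auto
    show "(u, v) \<notin> parcs (graph_power (spider (r + 1) (r * r)) (2 * r - 3))"
    proof (cases "a = b")
      case True
      then show ?thesis using ab by (simp add: graph_power_def)
    next
      case False
      then show ?thesis unfolding ab(3,4)
        using ab(1,2) l by (intro spider_leaves_not_adjacent) auto
    qed
  qed
  moreover have "card ?I = r + 1" by (subst card_image) (auto simp: inj_on_def)
  ultimately show False using assms by simp
qed

theorem mainTheorem4:
  fixes r :: nat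
  assumes "r \<ge> 2"
  shows "(\<forall>G :: 'a pair_pre_digraph.
            pair_graph G \<and> Digraph_Component.connected (with_proj G) \<and> r dvd card (pverts G)
              \<longrightarrow> has_K_factor r (graph_power G (2 * r - 2))) \<and>
         (\<exists>G :: nat pair_pre_digraph.
            pair_graph G \<and> Digraph_Component.connected (with_proj G) \<and> r dvd card (pverts G) \<and>
            \<not> has_K_factor r (graph_power G (2 * r - 3)))"
proof (intro conjI allI impI)
  fix G :: "'a pair_pre_digraph"
  assume "pair_graph G \<and> Digraph_Component.connected (with_proj G) \<and> r dvd card (pverts G)"
  then show "has_K_factor r (graph_power G (2 * r - 2))"
    using assms by (intro connected_graph_power_has_K_factor) auto
next
  have "Digraph_Component.connected (with_proj (spider (r + 1) (r * r)))"
    using assms by (intro connected_spider) auto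
  moreover have "r dvd card (pverts (spider (r + 1) (r * r)))" by simp
  ultimately show "\<exists>G :: nat pair_pre_digraph.
      pair_graph G \<and> Digraph_Component.connected (with_proj G) \<and> r dvd card (pverts G) \<and>
      \<not> has_K_factor r (graph_power G (2 * r - 3))"
    using pair_graph_spider spider_power_no_K_factor[OF assms] by blast
qed

end
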